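(* Let $D$ be a finite set, let $\Gamma$ be a valued constraint language over $D$ with $|\Gamma|$ finite, and let $\Gamma_d$ (over domain $D'\subseteq D^m$) be the dual of $\Gamma$. For every $k\ge1$, the map $f\mapsto f_d$, where for $f\in\mathrm{Pol}^{(k)}(\Gamma)$ the operation $f_d:(D')^k\to D'$ is defined by $f_d(\mathbf{x}_1,\dots,\mathbf{x}_k)=f(\mathbf{x}_1,\dots,\mathbf{x}_k)$ (componentwise application) for all $\mathbf{x}_1,\dots,\mathbf{x}_k\in D'$, is well defined and is a one-to-one correspondence between $\mathrm{Pol}^{(k)}(\Gamma)$ and $\mathrm{Pol}^{(k)}(\Gamma_d)$.
   Context: Let $\overline{\mathbb{Q}}=\mathbb{Q}\cup\{\infty\}$. An $m$-ary cost function over $D$ is a map $\phi:D^m\to\overline{\mathbb{Q}}$, with $\mathrm{Feas}(\phi)=\{\mathbf{x}\in D^m:\phi(\mathbf{x})<\infty\}$; $\mathbf{x}[i]$ is the $i$th component. For an operation $f:D^k\to D$, $f(\mathbf{x}_1,\dots,\mathbf{x}_k)$ on tuples denotes componentwise application. $f$ is a polymorphism of $\phi$ if it maps $k$-tuples of members of $\mathrm{Feas}(\phi)$ (componentwise) into $\mathrm{Feas}(\phi)$; $\mathrm{Pol}(\Gamma)$ is the set of operations that are polymorphisms of all members of $\Gamma$, and $\mathrm{Pol}^{(k)}(\Gamma)$ its $k$-ary members. The combined cost function: write $\Gamma=\{\phi_1,\dots,\phi_q\}$ (none identically $\infty$) with arities $m_1,\dots,m_q$, $m=\sum m_i$, and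 $\phi_\Gamma(x_1,\dots,x_m)=\phi_1(x_1,\dots,x_{m_1})+\dots+\phi_q(x_{m-m_q+1},\dots,x_m)$; $D'=\mathrm{Feas}(\phi_\Gamma)$. The dual $\Gamma_d$ is the language over domain $D'$ consisting of the unary cost function $\phi'_\Gamma(\mathbf{x})=\phi_\Gamma(\mathbf{x})$ for $\mathbf{x}\in D'$, and for all $i,j\in\{1,\dots,m\}$ the binary relation $\mathrm{match}_{i,j}(\mathbf{x},\mathbf{y})$ equal to $0$ if $\mathbf{x}[i]=\mathbf{y}[j]$ and $\infty$ otherwise.
   Formalization: The map is always well defined and onto, but injectivity fails in general (D={0,1}, one unary φ with φ(0)=0, φ(1)=∞, k=1); the one-to-one correspondence is stated only when every k-tuple over D has all its entries among the values of one common component of D'. *)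

theory Defs
  imports Main "HOL.Rat" "HOL-Library.FuncSet"
begin

datatype ext_rat = Fin rat | PInf ("\<infinity>")

instantiation ext_rat :: comm_monoid_add
begin

definition zero_ext_rat :: ext_rat where "0 = Fin 0"

fun plus_ext_rat :: "ext_rat \<Rightarrow> ext_rat \<Rightarrow> ext_rat" where
  "Fin a + Fin b = Fin (a + b)"
| "\<infinity> + y = \<infinity>"
| "Fin a + \<infinity> = \<infinity>"

instance
proof
  fix a b c :: ext_rat
  show "a + b + c = a + (b + c)" by (cases a; cases b; cases c) (auto simp: add.assoc)
  show "a + b = b + a" by (cases a; cases b) (auto simp: add.commute)
  show "0 + a = a" by (cases a) (auto simp: zero_ext_rat_def)
qed

end

instantiation ext_rat :: linorder
begin

fun less_eq_ext_rat :: "ext_rat \<Rightarrow> ext_rat \<Rightarrow> bool" where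
  "x \<le> \<infinity> \<longleftrightarrow> True"
| "Fin a \<le> Fin b \<longleftrightarrow> a \<le> b"
| "\<infinity> \<le> Fin b \<longleftrightarrow> False"

definition less_ext_rat :: "ext_rat \<Rightarrow> ext_rat \<Rightarrow> bool" where
  "x < y \<longleftrightarrow> x \<le> y \<and> \<not> y \<le> (x :: ext_rat)"

instance
proof
  fix x y z :: ext_rat
  show "x < y \<longleftrightarrow> x \<le> y \<and> \<not> y \<le> x" by (rule less_ext_rat_def)
  show "x \<le> x" by (cases x) auto
  show "x \<le> y \<Longrightarrow> y \<le> z \<Longrightarrow> x \<le> z" by (cases x; cases y; cases z) auto
  show "x \<le> y \<Longrightarrow> y \<le> x \<Longrightarrow> x = y" by (cases x; cases y) auto
  show "x \<le> y \<or> y \<le> x" by (cases x; cases y) auto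
qed

end

text \<open>
  Elements of \<open>D\<^sup>m\<close> are lists of length \<open>m\<close>; components are indexed from 0. Domains are sets
  rather than types because the domain of the dual is a set of tuples. A cost function is paired
  with its arity and, like an operation, is \<open>undefined\<close> outside its domain, so that equality of
  cost functions or operations is equality of the maps on \<open>D\<^sup>m\<close>.
\<close>

definition tuples :: "nat \<Rightarrow> 'a set \<Rightarrow> 'a list set" where
  "tuples m D = {x. length x = m \<and> set x \<subseteq> D}"

type_synonym 'a cost_fun = "nat \<times> ('a list \<Rightarrow> ext_rat)"

definition cost_functions :: "'a set \<Rightarrow> 'a cost_fun set" where
  "cost_functions D = {(m, \<phi>). \<phi> \<in> tuples m D \<rightarrow>\<^sub>E UNIV}"

definition valued_constraint_language :: "'a set \<Rightarrow> 'a cost_fun set \<Rightarrow> bool" where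
  "valued_constraint_language D \<Gamma> \<longleftrightarrow> \<Gamma> \<subseteq> cost_functions D"

definition Feas :: "'a set \<Rightarrow> 'a cost_fun \<Rightarrow> 'a list set" where
  "Feas D c = {x \<in> tuples (fst c) D. snd c x < \<infinity>}"

definition operations :: "nat \<Rightarrow> 'a set \<Rightarrow> ('a list \<Rightarrow> 'a) set" where
  "operations k D = tuples k D \<rightarrow>\<^sub>E D"

text \<open>Here \<open>xs\<close> is the list of the argument tuples, each of length \<open>m\<close>.\<close>

definition componentwise :: "nat \<Rightarrow> ('a list \<Rightarrow> 'a) \<Rightarrow> 'a list list \<Rightarrow> 'a list" where
  "componentwise m f xs = map (\<lambda>i. f (map (\<lambda>x. x ! i) xs)) [0..<m]"

definition polymorphism :: "nat \<Rightarrow> 'a set \<Rightarrow> ('a list \<Rightarrow> 'a) \<Rightarrow> 'a cost_fun \<Rightarrow> bool" where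
  "polymorphism k D f c \<longleftrightarrow>
     (\<forall>xs \<in> tuples k (Feas D c). componentwise (fst c) f xs \<in> Feas D c)"

definition Pol :: "nat \<Rightarrow> 'a set \<Rightarrow> 'a cost_fun set \<Rightarrow> ('a list \<Rightarrow> 'a) set" where
  "Pol k D \<Gamma> = {f \<in> operations k D. \<forall>c \<in> \<Gamma>. polymorphism k D f c}"

text \<open>
  The combined cost function depends on an enumeration of the language, given as a list.
\<close>

definition combined_arity :: "'a cost_fun list \<Rightarrow> nat" where
  "combined_arity cs = sum_list (map fst cs)"

fun combined_value :: "'a cost_fun list \<Rightarrow> 'a list \<Rightarrow> ext_rat" where
  "combined_value [] x = 0"
| "combined_value ((m, \<phi>) # cs) x = \<phi> (take m x) + combined_value cs (drop m x)"

definition combined :: "'a set \<Rightarrow> 'a cost_fun list \<Rightarrow> 'a cost_fun" where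
  "combined D cs =
     (combined_arity cs, restrict (combined_value cs) (tuples (combined_arity cs) D))"

definition dual_domain :: "'a set \<Rightarrow> 'a cost_fun list \<Rightarrow> 'a list set" where
  "dual_domain D cs = Feas D (combined D cs)"

definition dual_cost :: "'a set \<Rightarrow> 'a cost_fun list \<Rightarrow> 'a list cost_fun" where
  "dual_cost D cs =
     (1, \<lambda>xs \<in> tuples 1 (dual_domain D cs). snd (combined D cs) (xs ! 0))"

definition match_rel :: "'a set \<Rightarrow> 'a cost_fun list \<Rightarrow> nat \<Rightarrow> nat \<Rightarrow> 'a list cost_fun" where
  "match_rel D cs i j =
     (2, \<lambda>xs \<in> tuples 2 (dual_domain D cs). if xs ! 0 ! i = xs ! 1 ! j then 0 else \<infinity>)"

definition dual :: "'a set \<Rightarrow> 'a cost_fun list \<Rightarrow> 'a list cost_fun set" where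
  "dual D cs = insert (dual_cost D cs)
     {match_rel D cs i j | i j. i < combined_arity cs \<and> j < combined_arity cs}"

definition dual_op ::
    "nat \<Rightarrow> 'a set \<Rightarrow> 'a cost_fun list \<Rightarrow> ('a list \<Rightarrow> 'a) \<Rightarrow> 'a list list \<Rightarrow> 'a list" where
  "dual_op k D cs f =
     (\<lambda>xs \<in> tuples k (dual_domain D cs). componentwise (combined_arity cs) f xs)"

text \<open>
  Componentwise application to tuples of \<open>D'\<close> only evaluates \<open>f\<close> at those members of \<open>D\<^sup>k\<close> whose
  entries all occur at one common component of \<open>D'\<close>. If this misses a member of \<open>D\<^sup>k\<close>, the value
  of a polymorphism there is unconstrained and invisible to the dual. For example, if the only
  cost function is unary on \<open>{a, b}\<close>, finite at \<open>a\<close> and infinite at \<open>b\<close>, there are two unary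
  polymorphisms but \<open>D'\<close> is a singleton.
\<close>

definition all_arguments_occur :: "nat \<Rightarrow> 'a set \<Rightarrow> 'a cost_fun list \<Rightarrow> bool" where
  "all_arguments_occur k D cs \<longleftrightarrow>
     (\<forall>a \<in> tuples k D. \<exists>i < combined_arity cs. set a \<subseteq> (\<lambda>x. x ! i) ` dual_domain D cs)"

end

theory Submission
  imports Defs
begin

text \<open>
  \<open>D'\<close> consists of all concatenations of feasible tuples of the members of \<open>\<Gamma>\<close>, so polymorphisms
  of \<open>\<Gamma>\<close> preserve \<open>D'\<close>, and componentwise application preserves the match relations.
  Conversely, let \<open>g\<close> be a polymorphism of the dual. Preservation of the match relations says
  that the \<open>i\<close>th component of \<open>g(x\<^sub>1, \<dots>, x\<^sub>k)\<close> depends only on \<open>(x\<^sub>1[i], \<dots>, x\<^sub>k[i])\<close>, and in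
  the same way for every \<open>i\<close>; this defines \<open>f\<close> on the members of \<open>D\<^sup>k\<close> that occur at a component
  of \<open>D'\<close>, and elsewhere \<open>f\<close> may be taken to be the first projection. Since no member of \<open>\<Gamma>\<close> is
  identically infinite, feasible tuples of a single member extend to \<open>D'\<close>, so \<open>f\<close> is a
  polymorphism of \<open>\<Gamma>\<close>.
\<close>

section \<open>Extended rationals, componentwise application and tuples\<close>

lemma add_less_PInf_iff: "x + y < \<infinity> \<longleftrightarrow> x < \<infinity> \<and> y < (\<infinity> :: ext_rat)"
  by (cases x; cases y) (auto simp: less_ext_rat_def)

lemma zero_less_PInf: "0 < (\<infinity> :: ext_rat)"
  by (simp add: less_ext_rat_def zero_ext_rat_def)

lemma length_componentwise [simp]: "length (componentwise m f xs) = m"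
  by (simp add: componentwise_def)

lemma nth_componentwise [simp]:
  "i < m \<Longrightarrow> componentwise m f xs ! i = f (map (\<lambda>x. x ! i) xs)"
  by (simp add: componentwise_def)

lemma map_in_tuples:
  "\<lbrakk>xs \<in> tuples k A; \<And>x. x \<in> A \<Longrightarrow> h x \<in> B\<rbrakk> \<Longrightarrow> map h xs \<in> tuples k B"
  by (auto simp: tuples_def)

lemma nth_in_of_tuples: "\<lbrakk>x \<in> tuples m D; i < m\<rbrakk> \<Longrightarrow> x ! i \<in> D"
  by (auto simp: tuples_def)

text \<open>Preimages are chosen entry by entry. With \<open>h\<close> reading off component
  \<open>i\<close>, this lifts a tuple over \<open>D\<close> to a tuple over the dual
  domain.\<close>

lemma tuples_image_preimage:
  assumes "a \<in> tuples k D" and "set a \<subseteq> h ` A"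
  obtains xs where "xs \<in> tuples k A" and "a = map h xs"
proof
  let ?xs = "map (inv_into A h) a"
  show "?xs \<in> tuples k A"
    using assms by (auto simp: tuples_def intro: inv_into_into)
  show "a = map h ?xs"
    using assms(2) by (auto simp: f_inv_into_f intro!: map_idI[symmetric] dest!: subsetD)
qed

section \<open>The dual domain as a set of concatenations\<close>

lemma combined_arity_simps [simp]:
  "combined_arity [] = 0"
  "combined_arity (c # cs) = fst c + combined_arity cs"
  "combined_arity (cs @ cs') = combined_arity cs + combined_arity cs'"
  by (simp_all add: combined_arity_def)

lemma dual_domain_altdef:
  "dual_domain D cs = {x \<in> tuples (combined_arity cs) D. combined_value cs x < \<infinity>}"
  by (auto simp: dual_domain_def Feas_def combined_def)

lemma dual_domain_subset_tuples: "x \<in> dual_domain D cs \<Longrightarrow> x \<in> tuples (combined_arity cs) D"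
  by (simp add: dual_domain_altdef)

lemma length_dual_domain: "x \<in> dual_domain D cs \<Longrightarrow> length x = combined_arity cs"
  by (simp add: dual_domain_altdef tuples_def)

lemma dual_domain_Nil: "dual_domain D [] = {[]}"
  by (auto simp: dual_domain_altdef tuples_def zero_less_PInf)

text \<open>A sum in \<open>ext_rat\<close> is finite exactly when both summands are, so feasibility
  can be tested block by block.\<close>

lemma dual_domain_Cons_iff:
  "x \<in> dual_domain D (c # cs) \<longleftrightarrow>
     take (fst c) x \<in> Feas D c \<and> drop (fst c) x \<in> dual_domain D cs" (is "?L \<longleftrightarrow> ?R")
proof -
  obtain m \<phi> where c: "c = (m, \<phi>)" by (cases c)
  have tuples: "x \<in> tuples (m + n) D \<longleftrightarrow> take m x \<in> tuples m D \<and> drop m x \<in> tuples n D"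
    if "m \<le> length x" for n
    using that set_append[of "take m x" "drop m x"] by (auto simp: tuples_def)
  \<comment> \<open>On the right-hand side the bound comes from \<open>take m x\<close> having
    length \<open>m\<close>.\<close>
  have "m \<le> length x" if "?L \<or> ?R"
    using that by (auto simp: c dual_domain_altdef Feas_def tuples_def min_def split: if_splits)
  with tuples show ?thesis
    by (auto simp: c dual_domain_altdef Feas_def add_less_PInf_iff)
qed

lemma dual_domain_append_iff:
  "x \<in> dual_domain D (cs @ cs') \<longleftrightarrow>
     take (combined_arity cs) x \<in> dual_domain D cs \<and>
     drop (combined_arity cs) x \<in> dual_domain D cs'"
proof (induction cs arbitrary: x)
  case Nil
  then show ?case by (simp add: dual_domain_Nil)
next
  case (Cons c cs)
  then show ?case
    by (simp add: dual_domain_Cons_iff take_drop add.commute min_def)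
qed

text \<open>One feasible tuple per member is concatenated. This later supplies the padding that
  extends a feasible tuple of one member to the dual domain.\<close>

lemma dual_domain_nonempty:
  assumes "\<forall>c \<in> set cs. Feas D c \<noteq> {}"
  shows "dual_domain D cs \<noteq> {}"
  using assms
proof (induction cs)
  case Nil
  then show ?case by (simp add: dual_domain_Nil)
next
  case (Cons c cs)
  then obtain x y where "x \<in> Feas D c" and "y \<in> dual_domain D cs" by auto
  moreover from this have "length x = fst c" by (simp add: Feas_def tuples_def)
  ultimately have "x @ y \<in> dual_domain D (c # cs)" by (simp add: dual_domain_Cons_iff)
  then show ?case by blast
qed

text \<open>The length bound makes entry \<open>i\<close> of \<open>drop m x\<close> equal to entry
  \<open>m + i\<close> of \<open>x\<close>.\<close>

lemma componentwise_add:
  assumes "\<And>x. x \<in> set xs \<Longrightarrow> m \<le> length x"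
  shows "take m (componentwise (m + n) f xs) = componentwise m f (map (take m) xs)"
    and "drop m (componentwise (m + n) f xs) = componentwise n f (map (drop m) xs)"
  using assms by (auto intro!: nth_equalityI arg_cong[where f = f])

text \<open>This is the well-definedness of the dual operation: each block is preserved because
  \<open>f\<close> is a polymorphism of the member owning that block.\<close>

lemma componentwise_in_dual_domain:
  assumes "\<And>c. c \<in> set cs \<Longrightarrow> polymorphism k D f c" and "xs \<in> tuples k (dual_domain D cs)"
  shows "componentwise (combined_arity cs) f xs \<in> dual_domain D cs"
  using assms
proof (induction cs arbitrary: xs)
  case Nil
  then show ?case by (simp add: dual_domain_Nil componentwise_def)
next
  case (Cons c cs)
  have "map (take (fst c)) xs \<in> tuples k (Feas D c)"
    and drop: "map (drop (fst c)) xs \<in> tuples k (dual_domain D cs)"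
    using Cons.prems(2) by (auto elim!: map_in_tuples simp: dual_domain_Cons_iff)
  moreover have "polymorphism k D f c" using Cons.prems(1) by simp
  ultimately have "componentwise (fst c) f (map (take (fst c)) xs) \<in> Feas D c"
    by (simp add: polymorphism_def)
  moreover have "componentwise (combined_arity cs) f (map (drop (fst c)) xs) \<in> dual_domain D cs"
    using Cons.IH Cons.prems(1) drop by simp
  moreover have "fst c \<le> length x" if "x \<in> set xs" for x
    using that Cons.prems(2) length_dual_domain[of x D "c # cs"] by (auto simp: tuples_def)
  ultimately show ?case
    by (simp add: dual_domain_Cons_iff componentwise_add)
qed

section \<open>Polymorphisms of the dual\<close>

lemma tuples_1: "tuples 1 A = {[x] | x. x \<in> A}"
  by (auto simp: tuples_def length_Suc_conv)

lemma tuples_2: "tuples 2 A = {[x, y] | x y. x \<in> A \<and> y \<in> A}"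
  by (auto simp: tuples_def length_Suc_conv numeral_2_eq_2)

lemma Feas_dual_cost:
  "Feas (dual_domain D cs) (dual_cost D cs) = {[x] | x. x \<in> dual_domain D cs}"
proof -
  have "snd (combined D cs) x < \<infinity>" if "x \<in> dual_domain D cs" for x
    using that by (simp add: dual_domain_def Feas_def)
  then show ?thesis by (auto simp: Feas_def dual_cost_def tuples_1[unfolded One_nat_def])
qed

lemma Feas_match_rel:
  "Feas (dual_domain D cs) (match_rel D cs i j) =
     {[x, y] | x y. x \<in> dual_domain D cs \<and> y \<in> dual_domain D cs \<and> x ! i = y ! j}"
  by (auto simp: Feas_def match_rel_def tuples_2 zero_less_PInf split: if_splits)

text \<open>The unary cost is finite on the whole dual domain, so only the match relations restrict
  the polymorphisms of the dual.\<close>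

lemma polymorphism_dual_cost:
  assumes "g \<in> operations k (dual_domain D cs)"
  shows "polymorphism k (dual_domain D cs) g (dual_cost D cs)"
  unfolding polymorphism_def
proof
  fix zs assume "zs \<in> tuples k (Feas (dual_domain D cs) (dual_cost D cs))"
  then have "map (\<lambda>z. z ! 0) zs \<in> tuples k (dual_domain D cs)"
    by (rule map_in_tuples) (auto simp: Feas_dual_cost)
  then have "g (map (\<lambda>z. z ! 0) zs) \<in> dual_domain D cs"
    using assms by (auto simp: operations_def)
  then show "componentwise (fst (dual_cost D cs)) g zs
               \<in> Feas (dual_domain D cs) (dual_cost D cs)"
    unfolding Feas_dual_cost by (simp add: componentwise_def dual_cost_def)
qed

text \<open>A \<open>k\<close>-tuple of matching pairs is the same as two \<open>k\<close>-tuples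
  whose components \<open>i\<close> and \<open>j\<close> agree entrywise: zipping gives one
  direction, projecting to the two entries the other.\<close>

lemma polymorphism_match_rel_iff:
  assumes "g \<in> operations k (dual_domain D cs)"
  shows "polymorphism k (dual_domain D cs) g (match_rel D cs i j) \<longleftrightarrow>
     (\<forall>xs \<in> tuples k (dual_domain D cs). \<forall>ys \<in> tuples k (dual_domain D cs).
        map (\<lambda>x. x ! i) xs = map (\<lambda>y. y ! j) ys \<longrightarrow> g xs ! i = g ys ! j)"
    (is "?L \<longleftrightarrow> ?R")
proof -
  let ?D = "dual_domain D cs" and ?c = "match_rel D cs i j"
  have comp: "componentwise (fst ?c) g zs = [g (map (\<lambda>z. z ! 0) zs), g (map (\<lambda>z. z ! 1) zs)]" for zs
    by (simp add: componentwise_def match_rel_def upt_rec numeral_2_eq_2)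
  have g_in: "g xs \<in> ?D" if "xs \<in> tuples k ?D" for xs
    using assms that by (auto simp: operations_def)
  show ?thesis
  proof
    assume L: ?L
    show ?R
    proof (intro ballI impI)
      fix xs ys assume xs: "xs \<in> tuples k ?D" and ys: "ys \<in> tuples k ?D"
        and eq: "map (\<lambda>x. x ! i) xs = map (\<lambda>y. y ! j) ys"
      let ?zs = "map2 (\<lambda>x y. [x, y]) xs ys"
      have len: "length xs = k" "length ys = k" using xs ys by (simp_all add: tuples_def)
      have "x ! i = y ! j \<and> x \<in> ?D \<and> y \<in> ?D" if "(x, y) \<in> set (zip xs ys)" for x y
      proof -
        from that len obtain n where n: "n < k" "x = xs ! n" "y = ys ! n"
          by (auto simp: set_zip)
        then have "map (\<lambda>x. x ! i) xs ! n = map (\<lambda>y. y ! j) ys ! n" using eq by simp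
        then show ?thesis using n len xs ys by (auto simp: nth_in_of_tuples)
      qed
      then have "?zs \<in> tuples k (Feas ?D ?c)"
        using len by (auto simp: tuples_def Feas_match_rel)
      with L have "componentwise (fst ?c) g ?zs \<in> Feas ?D ?c"
        by (auto simp: polymorphism_def)
      moreover have "map (\<lambda>z. z ! 0) ?zs = xs" "map (\<lambda>z. z ! 1) ?zs = ys"
        using len by (auto intro: nth_equalityI)
      ultimately show "g xs ! i = g ys ! j"
        unfolding comp by (simp add: Feas_match_rel)
    qed
  next
    assume R: ?R
    show ?L
      unfolding polymorphism_def
    proof
      fix zs assume zs: "zs \<in> tuples k (Feas ?D ?c)"
      have "map (\<lambda>z. z ! 0) zs \<in> tuples k ?D" "map (\<lambda>z. z ! 1) zs \<in> tuples k ?D"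
        by (rule map_in_tuples[OF zs], force simp: Feas_match_rel)+
      moreover have "map (\<lambda>x. x ! i) (map (\<lambda>z. z ! 0) zs) = map (\<lambda>y. y ! j) (map (\<lambda>z. z ! 1) zs)"
        using zs by (auto simp: tuples_def Feas_match_rel)
      ultimately show "componentwise (fst ?c) g zs \<in> Feas ?D ?c"
        unfolding comp using R g_in by (auto simp: Feas_match_rel)
    qed
  qed
qed

lemma Pol_dual_iff:
  "g \<in> Pol k (dual_domain D cs) (dual D cs) \<longleftrightarrow>
     g \<in> operations k (dual_domain D cs) \<and>
     (\<forall>i < combined_arity cs. \<forall>j < combined_arity cs.
        \<forall>xs \<in> tuples k (dual_domain D cs). \<forall>ys \<in> tuples k (dual_domain D cs).
          map (\<lambda>x. x ! i) xs = map (\<lambda>y. y ! j) ys \<longrightarrow> g xs ! i = g ys ! j)"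
proof (cases "g \<in> operations k (dual_domain D cs)")
  case True
  then have "g \<in> Pol k (dual_domain D cs) (dual D cs) \<longleftrightarrow>
      (\<forall>i < combined_arity cs. \<forall>j < combined_arity cs.
         polymorphism k (dual_domain D cs) g (match_rel D cs i j))"
    unfolding Pol_def dual_def using polymorphism_dual_cost by blast
  then show ?thesis using True by (simp add: polymorphism_match_rel_iff)
qed (simp add: Pol_def)

section \<open>From operations on \<open>D\<close> to operations on the dual domain\<close>

lemma dual_op_in_operations:
  assumes "f \<in> Pol k D (set cs)"
  shows "dual_op k D cs f \<in> operations k (dual_domain D cs)"
  using assms componentwise_in_dual_domain[of cs k D f]
  by (auto simp: operations_def dual_op_def Pol_def)

lemma nth_dual_op:
  "\<lbrakk>xs \<in> tuples k (dual_domain D cs); i < combined_arity cs\<rbrakk> \<Longrightarrow>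
     dual_op k D cs f xs ! i = f (map (\<lambda>x. x ! i) xs)"
  by (simp add: dual_op_def)

lemma dual_op_in_Pol_dual:
  assumes "f \<in> Pol k D (set cs)"
  shows "dual_op k D cs f \<in> Pol k (dual_domain D cs) (dual D cs)"
  using assms by (simp add: Pol_dual_iff dual_op_in_operations nth_dual_op)

text \<open>Every argument \<open>a\<close> is read off at some component \<open>i\<close> of tuples
  in the dual domain, so \<open>f a\<close> appears as an entry of a value of
  \<open>dual_op k D cs f\<close>.\<close>

lemma inj_on_dual_op:
  assumes "all_arguments_occur k D cs"
  shows "inj_on (dual_op k D cs) (operations k D)"
proof (rule inj_onI)
  fix f f' assume f: "f \<in> operations k D" and f': "f' \<in> operations k D"
    and eq: "dual_op k D cs f = dual_op k D cs f'"
  have "f a = f' a" if a: "a \<in> tuples k D" for a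
  proof -
    from a assms obtain i where i: "i < combined_arity cs"
      and "set a \<subseteq> (\<lambda>x. x ! i) ` dual_domain D cs"
      by (auto simp: all_arguments_occur_def)
    with a obtain xs where "xs \<in> tuples k (dual_domain D cs)" and "a = map (\<lambda>x. x ! i) xs"
      by (blast elim: tuples_image_preimage)
    with i eq show "f a = f' a" by (metis nth_dual_op)
  qed
  then show "f = f'"
    using f f' unfolding operations_def by (rule PiE_ext[rotated 2])
qed

section \<open>Recovering an operation on \<open>D\<close> from one on the dual domain\<close>

text \<open>
  The first projection, used as the default value, needs \<open>k \<ge> 1\<close> to take its values in \<open>D\<close>.
\<close>

definition primal_op ::
    "nat \<Rightarrow> 'a set \<Rightarrow> 'a cost_fun list \<Rightarrow> ('a list list \<Rightarrow> 'a list) \<Rightarrow> 'a list \<Rightarrow> 'a" where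
  "primal_op k D cs g =
     (\<lambda>a \<in> tuples k D.
        if \<exists>i xs. i < combined_arity cs \<and> xs \<in> tuples k (dual_domain D cs) \<and>
             a = map (\<lambda>x. x ! i) xs
        then SOME v. \<exists>i xs. i < combined_arity cs \<and> xs \<in> tuples k (dual_domain D cs) \<and>
             a = map (\<lambda>x. x ! i) xs \<and> v = g xs ! i
        else hd a)"

lemma map_nth_in_tuples:
  assumes "xs \<in> tuples k (dual_domain D cs)" and "i < combined_arity cs"
  shows "map (\<lambda>x. x ! i) xs \<in> tuples k D"
  using assms by (auto elim!: map_in_tuples dest!: dual_domain_subset_tuples nth_in_of_tuples)

text \<open>The value picked by \<open>SOME\<close> is unique: if the same argument is read off at
  component \<open>i\<close> of \<open>xs\<close> and at component \<open>j\<close> of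
  \<open>ys\<close>, preservation of the match relation for \<open>i\<close> and \<open>j\<close>
  forces equal entries.\<close>

lemma primal_op_map_nth:
  assumes g: "g \<in> Pol k (dual_domain D cs) (dual D cs)"
    and xs: "xs \<in> tuples k (dual_domain D cs)" and i: "i < combined_arity cs"
  shows "primal_op k D cs g (map (\<lambda>x. x ! i) xs) = g xs ! i"
proof -
  let ?P = "\<lambda>v. \<exists>j ys. j < combined_arity cs \<and> ys \<in> tuples k (dual_domain D cs) \<and>
          map (\<lambda>x. x ! i) xs = map (\<lambda>x. x ! j) ys \<and> v = g ys ! j"
  have occurs: "\<exists>j ys. j < combined_arity cs \<and> ys \<in> tuples k (dual_domain D cs) \<and>
          map (\<lambda>x. x ! i) xs = map (\<lambda>x. x ! j) ys"
    using xs i by blast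
  have "?P (g xs ! i)" using xs i by blast
  moreover have "v = g xs ! i" if "?P v" for v
  proof -
    from that obtain j ys where "j < combined_arity cs" "ys \<in> tuples k (dual_domain D cs)"
      "map (\<lambda>x. x ! i) xs = map (\<lambda>x. x ! j) ys" and v: "v = g ys ! j" by blast
    with g xs i have "g xs ! i = g ys ! j" unfolding Pol_dual_iff by blast
    with v show ?thesis by simp
  qed
  ultimately have "(SOME v. ?P v) = g xs ! i" by (rule some_equality)
  then show ?thesis
    unfolding primal_op_def restrict_apply if_P[OF map_nth_in_tuples[OF xs i]] if_P[OF occurs] .
qed

lemma primal_op_in_operations:
  assumes g: "g \<in> Pol k (dual_domain D cs) (dual D cs)" and "k \<ge> 1"
  shows "primal_op k D cs g \<in> operations k D"
  unfolding operations_def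
proof (rule PiE_I)
  fix a assume a: "a \<in> tuples k D"
  show "primal_op k D cs g a \<in> D"
  proof (cases "\<exists>i xs. i < combined_arity cs \<and> xs \<in> tuples k (dual_domain D cs) \<and>
                  a = map (\<lambda>x. x ! i) xs")
    case True
    then obtain i xs where i: "i < combined_arity cs" and xs: "xs \<in> tuples k (dual_domain D cs)"
      and "a = map (\<lambda>x. x ! i) xs" by blast
    moreover have "g xs \<in> dual_domain D cs" using g xs by (auto simp: Pol_def operations_def)
    ultimately show ?thesis
      by (simp add: primal_op_map_nth[OF g] nth_in_of_tuples[OF dual_domain_subset_tuples])
  next
    case False
    have "hd a \<in> D" using a \<open>k \<ge> 1\<close> by (cases a) (auto simp: tuples_def)
    moreover have "primal_op k D cs g a = hd a"
      unfolding primal_op_def restrict_apply if_P[OF a] using False by (rule if_not_P)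
    ultimately show ?thesis by simp
  qed
qed (simp add: primal_op_def)

text \<open>Feasible tuples of \<open>c\<close> are padded to members of the dual domain,
  \<open>g\<close> is applied there, and the block of \<open>c\<close> is cut out of the
  result.\<close>

lemma polymorphism_primal_op:
  assumes g: "g \<in> Pol k (dual_domain D cs) (dual D cs)"
    and nonempty: "\<forall>c \<in> set cs. Feas D c \<noteq> {}" and "c \<in> set cs"
  shows "polymorphism k D (primal_op k D cs g) c"
  unfolding polymorphism_def
proof
  fix xs assume xs: "xs \<in> tuples k (Feas D c)"
  from \<open>c \<in> set cs\<close> obtain ps qs where cs: "cs = ps @ c # qs"
    by (blast dest: split_list)
  obtain p q where p: "p \<in> dual_domain D ps" and q: "q \<in> dual_domain D qs"
    using nonempty cs dual_domain_nonempty[of ps D] dual_domain_nonempty[of qs D] by auto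
  define n where "n = combined_arity ps"
  \<comment> \<open>The same padding \<open>p\<close>, \<open>q\<close> serves all \<open>k\<close>
    arguments; the block of \<open>c\<close> then starts at position \<open>n\<close>.\<close>
  define ys where "ys = map (\<lambda>x. p @ x @ q) xs"
  have len: "length x = fst c" if "x \<in> Feas D c" for x
    using that by (simp add: Feas_def tuples_def)
  have lenp: "length p = n" using p by (simp add: n_def length_dual_domain)
  have ys: "ys \<in> tuples k (dual_domain D cs)"
    unfolding ys_def using xs
  proof (rule map_in_tuples)
    fix x assume "x \<in> Feas D c"
    with p q len lenp show "p @ x @ q \<in> dual_domain D cs"
      by (simp add: cs dual_domain_append_iff dual_domain_Cons_iff n_def)
  qed
  then have gys: "g ys \<in> dual_domain D cs" using g by (auto simp: Pol_def operations_def)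
  have "componentwise (fst c) (primal_op k D cs g) xs = take (fst c) (drop n (g ys))"
  proof (rule nth_equalityI)
    show "length (componentwise (fst c) (primal_op k D cs g) xs) =
            length (take (fst c) (drop n (g ys)))"
      using length_dual_domain[OF gys] by (simp add: cs n_def)
  next
    fix i assume "i < length (componentwise (fst c) (primal_op k D cs g) xs)"
    then have i: "i < fst c" by simp
    have "map (\<lambda>x. x ! i) xs = map (\<lambda>y. y ! (n + i)) ys"
      using xs len i lenp by (auto simp: ys_def tuples_def nth_append subset_iff)
    moreover have "n + i < combined_arity cs" using i by (simp add: cs n_def)
    ultimately show "componentwise (fst c) (primal_op k D cs g) xs ! i =
                       take (fst c) (drop n (g ys)) ! i"
      using i length_dual_domain[OF gys] by (simp add: primal_op_map_nth[OF g ys])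
  qed
  also have "\<dots> \<in> Feas D c"
    using gys by (simp add: cs dual_domain_append_iff dual_domain_Cons_iff n_def)
  finally show "componentwise (fst c) (primal_op k D cs g) xs \<in> Feas D c" .
qed

text \<open>This right inverse yields surjectivity. Inside the domain, each entry of the value is
  given by \<open>primal_op_map_nth\<close>.\<close>

lemma dual_op_primal_op:
  assumes g: "g \<in> Pol k (dual_domain D cs) (dual D cs)"
  shows "dual_op k D cs (primal_op k D cs g) = g"
proof
  fix xs
  show "dual_op k D cs (primal_op k D cs g) xs = g xs"
  proof (cases "xs \<in> tuples k (dual_domain D cs)")
    case True
    then have "g xs \<in> dual_domain D cs" using g by (auto simp: Pol_def operations_def)
    then show ?thesis
      using True
      by (auto intro!: nth_equalityI
          simp: dual_op_def length_dual_domain primal_op_map_nth[OF g])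
  next
    case False
    \<comment> \<open>Outside the domain both sides are \<open>undefined\<close>, so the two agree
      as functions.\<close>
    then show ?thesis using g by (auto simp: dual_op_def Pol_def operations_def)
  qed
qed

text \<open>The list \<open>cs\<close> fixes the order of the blocks. Surjectivity comes from
  \<open>primal_op\<close>; bijectivity is stated under \<open>all_arguments_occur\<close>, since
  values of \<open>f\<close> at arguments that never occur cannot be recovered from the dual
  operation.\<close>

theorem theorem4p6:
  fixes D :: "'a set" and \<Gamma> :: "'a cost_fun set" and cs :: "'a cost_fun list" and k :: nat
  assumes "finite D"
    and "valued_constraint_language D \<Gamma>"
    and "finite \<Gamma>"
    and "\<forall>c \<in> \<Gamma>. Feas D c \<noteq> {}"
    and "distinct cs" and "set cs = \<Gamma>"
    and "k \<ge> 1"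
  shows "(\<forall>f \<in> Pol k D \<Gamma>. dual_op k D cs f \<in> operations k (dual_domain D cs)) \<and>
         (\<forall>f \<in> Pol k D \<Gamma>. dual_op k D cs f \<in> Pol k (dual_domain D cs) (dual D cs)) \<and>
         dual_op k D cs ` Pol k D \<Gamma> = Pol k (dual_domain D cs) (dual D cs) \<and>
         (all_arguments_occur k D cs \<longrightarrow>
            bij_betw (dual_op k D cs) (Pol k D \<Gamma>) (Pol k (dual_domain D cs) (dual D cs)))"
proof -
  let ?D = "dual_domain D cs"
  have into: "dual_op k D cs f \<in> Pol k ?D (dual D cs)" if "f \<in> Pol k D \<Gamma>" for f
    using that dual_op_in_Pol_dual \<open>set cs = \<Gamma>\<close> by blast
  have "g \<in> dual_op k D cs ` Pol k D \<Gamma>" if g: "g \<in> Pol k ?D (dual D cs)" for g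
  proof (rule image_eqI)
    show "g = dual_op k D cs (primal_op k D cs g)" using g by (simp add: dual_op_primal_op)
    show "primal_op k D cs g \<in> Pol k D \<Gamma>"
      unfolding Pol_def
      using primal_op_in_operations[OF g \<open>k \<ge> 1\<close>] polymorphism_primal_op[OF g] assms(4,6)
      by simp
  qed
  with into have image: "dual_op k D cs ` Pol k D \<Gamma> = Pol k ?D (dual D cs)" by blast
  have "inj_on (dual_op k D cs) (Pol k D \<Gamma>)" if "all_arguments_occur k D cs"
    using inj_on_dual_op[OF that] by (rule inj_on_subset) (auto simp: Pol_def)
  with image have "all_arguments_occur k D cs \<longrightarrow>
      bij_betw (dual_op k D cs) (Pol k D \<Gamma>) (Pol k ?D (dual D cs))"
    by (simp add: bij_betw_def)
  moreover have "\<forall>f \<in> Pol k D \<Gamma>. dual_op k D cs f \<in> operations k ?D"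
    using into by (simp add: Pol_def)
  ultimately show ?thesis using into image by blast
qed

end
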